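(* Let $A$ be a triassociative algebra over a field $K$. If $H^2_{\mathrm{Trias}}(A,A)$ is trivial, then $A$ is rigid.
   Context: All vector spaces and tensor products are over a fixed field $K$. A triassociative algebra is a vector space $A$ with three bilinear operations $L=\dashv$, $R=\vdash$, $M=\bot$ satisfying, for all $x,y,z$, the following $11$ conditions: (1) $L(L(x,y),z)=L(x,L(y,z))$; (2) $L(L(x,y),z)=L(x,R(y,z))$; (3) $L(R(x,y),z)=R(x,L(y,z))$; (4) $R(L(x,y),z)=R(x,R(y,z))$; (5) $R(R(x,y),z)=R(x,R(y,z))$; (6) $L(L(x,y),z)=L(x,M(y,z))$; (7) $L(M(x,y),z)=M(x,L(y,z))$; (8) $M(L(x,y),z)=M(x,R(y,z))$; (9) $M(R(x,y),z)=R(x,M(y,z))$; (10) $R(M(x,y),z)=R(x,R(y,z))$; (11) $M(M(x,y),z)=M(x,M(y,z))$, where $L(x,y)=x\dashv y$, etc. Trees. $T_n$ ($n\ge0$) is the set of planar rooted trees with $n+1$ leaves in which every internal vertex has at least $2$ incoming edges ($T_0=\{|\}$, no internal vertex); $\psi\in T_n$ has degree $|\psi|=n$; leaves are numbered $0,\dots,n$ from left to right. The grafting $\psi_0\vee\cdots\vee\psi_k$ is obtained by arranging the trees from left to right and joining their roots to a new lowest internal vertex, connected to a new root; every tree of degree $\ge 1$ is uniquely of this form with $k\ge1$. A leaf is left (resp. right) oriented if it is the leftmost (resp. rightmost) incoming edge of the vertex it is attached to; otherwise it is a middle leaf. $d_i\colon T_{n+1}\to T_n$ deletes the $i$th leaf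 (suppressing any vertex left with one incoming edge). For $\psi=\psi_0\vee\cdots\vee\psi_k\in T_{n+1}$ and $0\le i\le n+1$ define $\circ_i^\psi\in\{\dashv,\vdash,\bot\}$ by: $\circ_0^\psi$ is $\dashv$ if $|\psi_0|=0$ and $k=1$; $\vdash$ if $|\psi_0|>0$; $\bot$ if $|\psi_0|=0$ and $k>1$. For $1\le i\le n$, $\circ_i^\psi$ is $\dashv$, $\vdash$, or $\bot$ according as the $i$th leaf is left oriented, right oriented, or a middle leaf. $\circ_{n+1}^\psi$ is $\dashv$ if $|\psi_k|>0$; $\vdash$ if $k=1$ and $|\psi_1|=0$; $\bot$ if $k>1$ and $|\psi_k|=0$. Cohomology. $C^n_{\mathrm{Trias}}(A,A)=\mathrm{Hom}_K(K[T_n]\otimes A^{\otimes n},A)$ for $n\ge 0$, with coboundary $\delta^n=\sum_{i=0}^{n+1}(-1)^i\delta_i^n\colon C^n_{\mathrm{Trias}}(A,A)\to C^{n+1}_{\mathrm{Trias}}(A,A)$, where for $\psi\in T_{n+1}$, $a_1,\dots,a_{n+1}\in A$: $(\delta_0^nf)(\psi;a_1,\dots,a_{n+1})=a_1\circ_0^\psi f(d_0\psi;a_2,\dots,a_{n+1})$; $(\delta_i^nf)(\psi;a_1,\dots,a_{n+1})=f(d_i\psi;a_1,\dots,a_i\circ_i^\psi a_{i+1},\dots,a_{n+1})$ for $1\le i\le n$; $(\delta_{n+1}^nf)(\psi;a_1,\dots,a_{n+1})=f(d_{n+1}\psi;a_1,\dots,a_n)\circ_{n+1}^\psi a_{n+1}$.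 This is a cochain complex, and $H^n_{\mathrm{Trias}}(A,A)$ is its $n$th cohomology. A $2$-cochain $\theta\in C^2_{\mathrm{Trias}}(A,A)$ is identified with a triple $(\lambda,\rho,\mu)$ of bilinear operations on $A$ by $\theta(\psi;x,y)=\lambda(x,y)$, $\rho(x,y)$, $\mu(x,y)$ for $\psi=|\vee(|\vee|)$, $(|\vee|)\vee|$, $|\vee|\vee|$ respectively. A deformation of $A$ is a power series $\Theta_t=\sum_{i=0}^\infty\theta_it^i$ with each $\theta_i=(\lambda_i,\rho_i,\mu_i)\in C^2_{\mathrm{Trias}}(A,A)$ and $\theta_0=(\dashv,\vdash,\bot)$, such that $L_t=\sum\lambda_it^i$, $R_t=\sum\rho_it^i$, $M_t=\sum\mu_it^i$ satisfy conditions (1)-(11) (with $L_t,R_t,M_t$ in place of $L,R,M$, extended linearly to power series) for all $x,y,z\in A$. A formal isomorphism of $A$ is a power series $\Phi_t=\sum_{i=0}^\infty\phi_it^i$ with $\phi_i\in\mathrm{Hom}_K(A,A)$ and $\phi_0=\mathrm{Id}_A$. Deformations $\Theta_t=(L_t,R_t,M_t)$ and $\overline\Theta_t=(\overline L_t,\overline R_t,\overline M_t)$ are equivalent if there is a formal isomorphism $\Phi_t$ with $\overline O_t(x,y)=\Phi_tO_t(\Phi_t^{-1}(x),\Phi_t^{-1}(y))$ for $O=L,R,M$ and all $x,y\in A$. The trivial deformation is $\Theta_t=(\dashv,\vdash,\bot)t^0$. $A$ is rigid if every deformation of $A$ is equivalent to the trivial deformation. *)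

theory Defs
  imports
    "HOL-Computational_Algebra.Formal_Power_Series"
    "HOL-Library.Function_Algebras"
begin

section \<open>Triassociative algebras\<close>

definition bilinear_op ::
  "('k::field \<Rightarrow> 'a::ab_group_add \<Rightarrow> 'a) \<Rightarrow> ('a \<Rightarrow> 'a \<Rightarrow> 'a) \<Rightarrow> bool" where
  "bilinear_op scale f \<longleftrightarrow>
     (\<forall>y. Vector_Spaces.linear scale scale (\<lambda>x. f x y)) \<and>
     (\<forall>x. Vector_Spaces.linear scale scale (\<lambda>y. f x y))"

text \<open>Stated over an arbitrary type, so that the same predicate serves for an algebra and for
  the power series over it. The operations \<open>\<stileturn>\<close>, \<open>\<turnstile>\<close>, \<open>\<bottom>\<close> are called \<open>L\<close>, \<open>R\<close>, \<open>M\<close>.\<close>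

definition trias_identities ::
  "('b \<Rightarrow> 'b \<Rightarrow> 'b) \<Rightarrow> ('b \<Rightarrow> 'b \<Rightarrow> 'b) \<Rightarrow> ('b \<Rightarrow> 'b \<Rightarrow> 'b) \<Rightarrow> 'b \<Rightarrow> 'b \<Rightarrow> 'b \<Rightarrow> bool" where
  "trias_identities L R M x y z \<longleftrightarrow>
     L (L x y) z = L x (L y z) \<and>
     L (L x y) z = L x (R y z) \<and>
     L (R x y) z = R x (L y z) \<and>
     R (L x y) z = R x (R y z) \<and>
     R (R x y) z = R x (R y z) \<and>
     L (L x y) z = L x (M y z) \<and>
     L (M x y) z = M x (L y z) \<and>
     M (L x y) z = M x (R y z) \<and>
     M (R x y) z = R x (M y z) \<and>
     R (M x y) z = R x (R y z) \<and>
     M (M x y) z = M x (M y z)"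

locale triassociative_algebra = vector_space scale
  for scale :: "'k::field \<Rightarrow> 'a::ab_group_add \<Rightarrow> 'a" +
  fixes L R M :: "'a \<Rightarrow> 'a \<Rightarrow> 'a"
  assumes bilinear_L: "bilinear_op scale L"
    and bilinear_R: "bilinear_op scale R"
    and bilinear_M: "bilinear_op scale M"
    and identities: "trias_identities L R M x y z"


section \<open>Planar trees\<close>

text \<open>\<open>Leaf\<close> is the tree \<open>|\<close> without internal vertices; \<open>Graft [\<psi>\<^sub>0, \<dots>, \<psi>\<^sub>k]\<close> is the grafting
  \<open>\<psi>\<^sub>0 \<or> \<dots> \<or> \<psi>\<^sub>k\<close>. The requirement of at least two incoming edges at every internal
  vertex is imposed by \<open>reduced\<close>.\<close>

datatype ptree = Leaf | Graft "ptree list"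

fun reduced :: "ptree \<Rightarrow> bool" where
  "reduced Leaf \<longleftrightarrow> True"
| "reduced (Graft ts) \<longleftrightarrow> 2 \<le> length ts \<and> (\<forall>t\<in>set ts. reduced t)"

fun num_leaves :: "ptree \<Rightarrow> nat" where
  "num_leaves Leaf = 1"
| "num_leaves (Graft ts) = sum_list (map num_leaves ts)"

definition degree :: "ptree \<Rightarrow> nat" where
  "degree t = num_leaves t - 1"

definition trees :: "nat \<Rightarrow> ptree set" where
  "trees n = {t. reduced t \<and> num_leaves t = n + 1}"

fun suppress :: "ptree list \<Rightarrow> ptree" where
  "suppress [t] = t"
| "suppress ts = Graft ts"

text \<open>\<open>del_leaf i t\<close> is \<open>d\<^sub>i t\<close>; leaves are numbered from 0, left to right. \<open>del_leaf_list i ts\<close>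
  deletes the \<open>i\<close>th leaf of the forest \<open>ts\<close>. The value at \<open>Leaf\<close> is immaterial.\<close>

fun del_leaf :: "nat \<Rightarrow> ptree \<Rightarrow> ptree"
  and del_leaf_list :: "nat \<Rightarrow> ptree list \<Rightarrow> ptree list" where
  "del_leaf i Leaf = Leaf"
| "del_leaf i (Graft ts) = suppress (del_leaf_list i ts)"
| "del_leaf_list i [] = []"
| "del_leaf_list i (t # ts) =
     (if i < num_leaves t then (if t = Leaf then ts else del_leaf i t # ts)
      else t # del_leaf_list (i - num_leaves t) ts)"

datatype trias_op = OpL | OpR | OpM

text \<open>\<open>leaf_op i t\<close> is \<open>OpL\<close>, \<open>OpR\<close> or \<open>OpM\<close> according as the \<open>i\<close>th leaf of \<open>t\<close> is left oriented,
  right oriented or a middle leaf. In \<open>leaf_op_list is_first i ts\<close> the list \<open>ts\<close> is a final segment of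
  the subtrees at a vertex, and \<open>is_first\<close> tells whether it is all of them. The values
  at \<open>Leaf\<close> and \<open>[]\<close> are irrelevant.\<close>

fun leaf_op :: "nat \<Rightarrow> ptree \<Rightarrow> trias_op"
  and leaf_op_list :: "bool \<Rightarrow> nat \<Rightarrow> ptree list \<Rightarrow> trias_op" where
  "leaf_op i Leaf = OpM"
| "leaf_op i (Graft ts) = leaf_op_list True i ts"
| "leaf_op_list is_first i [] = OpM"
| "leaf_op_list is_first i (t # ts) =
     (if i < num_leaves t then
        (if t = Leaf then (if is_first then OpL else if ts = [] then OpR else OpM)
         else leaf_op i t)
      else leaf_op_list False (i - num_leaves t) ts)"

text \<open>\<open>circ \<psi> i\<close> is \<open>\<circ>\<^sub>i\<^sup>\<psi>\<close>. For \<open>\<psi> = Graft ts\<close> one has \<open>k + 1 = length ts\<close>, so \<open>k = 1\<close> reads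
  \<open>length ts = 2\<close>, and the last index \<open>n + 1\<close> is the degree of \<open>\<psi>\<close>.\<close>

fun circ :: "ptree \<Rightarrow> nat \<Rightarrow> trias_op" where
  "circ Leaf i = OpM"
| "circ (Graft ts) i =
     (if i = 0 then
        (if degree (hd ts) > 0 then OpR else if length ts = 2 then OpL else OpM)
      else if i = degree (Graft ts) then
        (if degree (last ts) > 0 then OpL else if length ts = 2 then OpR else OpM)
      else leaf_op i (Graft ts))"


section \<open>Cochains and cohomology\<close>

text \<open>An element of \<open>Hom(K[T\<^sub>n] \<otimes> A\<^bsup>\<otimes>n\<^esup>, A)\<close> is given by a family, indexed by the basis
  \<open>T\<^sub>n\<close> of \<open>K[T\<^sub>n]\<close>, of \<open>n\<close>-linear maps. It is encoded as a function \<open>f \<psi> [a\<^sub>1, \<dots>, a\<^sub>n]\<close>, set to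
  zero outside its domain so that equality of cochains is equality of functions; addition
  and zero are pointwise.\<close>

type_synonym 'a cochain = "ptree \<Rightarrow> 'a list \<Rightarrow> 'a"

definition trias_C ::
  "('k::field \<Rightarrow> 'a::ab_group_add \<Rightarrow> 'a) \<Rightarrow> nat \<Rightarrow> 'a cochain set" where
  "trias_C scale n = {f.
     (\<forall>\<psi>\<in>trees n. \<forall>as. length as = n \<longrightarrow>
        (\<forall>i<n. Vector_Spaces.linear scale scale (\<lambda>x. f \<psi> (as[i := x])))) \<and>
     (\<forall>\<psi> as. \<psi> \<notin> trees n \<or> length as \<noteq> n \<longrightarrow> f \<psi> as = 0)}"

fun apply_op ::
  "('a \<Rightarrow> 'a \<Rightarrow> 'a) \<Rightarrow> ('a \<Rightarrow> 'a \<Rightarrow> 'a) \<Rightarrow> ('a \<Rightarrow> 'a \<Rightarrow> 'a) \<Rightarrow> trias_op \<Rightarrow> 'a \<Rightarrow> 'a \<Rightarrow> 'a" where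
  "apply_op L R M OpL = L"
| "apply_op L R M OpR = R"
| "apply_op L R M OpM = M"

text \<open>The list positions are shifted by one: \<open>a\<^sub>i\<close> is \<open>as ! (i - 1)\<close>.\<close>

definition trias_face ::
  "('a \<Rightarrow> 'a \<Rightarrow> 'a) \<Rightarrow> ('a \<Rightarrow> 'a \<Rightarrow> 'a) \<Rightarrow> ('a \<Rightarrow> 'a \<Rightarrow> 'a) \<Rightarrow> nat \<Rightarrow> nat \<Rightarrow> 'a cochain \<Rightarrow> 'a cochain" where
  "trias_face L R M n i f \<psi> as =
     (if i = 0 then
        apply_op L R M (circ \<psi> 0) (hd as) (f (del_leaf 0 \<psi>) (tl as))
      else if i = n + 1 then
        apply_op L R M (circ \<psi> (n + 1)) (f (del_leaf (n + 1) \<psi>) (butlast as)) (last as)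
      else
        f (del_leaf i \<psi>)
          (take (i - 1) as @ [apply_op L R M (circ \<psi> i) (as ! (i - 1)) (as ! i)]
             @ drop (i + 1) as))"

definition trias_coboundary ::
  "('k::field \<Rightarrow> 'a::ab_group_add \<Rightarrow> 'a) \<Rightarrow> ('a \<Rightarrow> 'a \<Rightarrow> 'a) \<Rightarrow> ('a \<Rightarrow> 'a \<Rightarrow> 'a) \<Rightarrow> ('a \<Rightarrow> 'a \<Rightarrow> 'a)
    \<Rightarrow> nat \<Rightarrow> 'a cochain \<Rightarrow> 'a cochain" where
  "trias_coboundary scale L R M n f \<psi> as =
     (if \<psi> \<in> trees (n + 1) \<and> length as = n + 1
      then \<Sum>i\<le>n + 1. scale ((- 1) ^ i) (trias_face L R M n i f \<psi> as)
      else 0)"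

definition trias_Z ::
  "('k::field \<Rightarrow> 'a::ab_group_add \<Rightarrow> 'a) \<Rightarrow> ('a \<Rightarrow> 'a \<Rightarrow> 'a) \<Rightarrow> ('a \<Rightarrow> 'a \<Rightarrow> 'a) \<Rightarrow> ('a \<Rightarrow> 'a \<Rightarrow> 'a)
    \<Rightarrow> nat \<Rightarrow> 'a cochain set" where
  "trias_Z scale L R M n = {f \<in> trias_C scale n. trias_coboundary scale L R M n f = 0}"

fun trias_B ::
  "('k::field \<Rightarrow> 'a::ab_group_add \<Rightarrow> 'a) \<Rightarrow> ('a \<Rightarrow> 'a \<Rightarrow> 'a) \<Rightarrow> ('a \<Rightarrow> 'a \<Rightarrow> 'a) \<Rightarrow> ('a \<Rightarrow> 'a \<Rightarrow> 'a)
    \<Rightarrow> nat \<Rightarrow> 'a cochain set" where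
  "trias_B scale L R M 0 = {0}"
| "trias_B scale L R M (Suc n) = trias_coboundary scale L R M n ` trias_C scale n"

text \<open>The quotient of cocycles by coboundaries, as a set of cosets. Its zero element is the coset
  of \<open>0\<close>, that is, \<open>trias_B scale L R M n\<close>.\<close>

definition trias_H ::
  "('k::field \<Rightarrow> 'a::ab_group_add \<Rightarrow> 'a) \<Rightarrow> ('a \<Rightarrow> 'a \<Rightarrow> 'a) \<Rightarrow> ('a \<Rightarrow> 'a \<Rightarrow> 'a) \<Rightarrow> ('a \<Rightarrow> 'a \<Rightarrow> 'a)
    \<Rightarrow> nat \<Rightarrow> 'a cochain set set" where
  "trias_H scale L R M n =
     (\<lambda>f. (\<lambda>b. f + b) ` trias_B scale L R M n) ` trias_Z scale L R M n"


section \<open>Deformations\<close>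

definition tree_L :: ptree where "tree_L = Graft [Leaf, Graft [Leaf, Leaf]]"
definition tree_R :: ptree where "tree_R = Graft [Graft [Leaf, Leaf], Leaf]"
definition tree_M :: ptree where "tree_M = Graft [Leaf, Leaf, Leaf]"

text \<open>The 2-cochain identified with a triple of bilinear operations.\<close>

definition cochain_of_ops ::
  "('a \<Rightarrow> 'a \<Rightarrow> 'a) \<Rightarrow> ('a \<Rightarrow> 'a \<Rightarrow> 'a) \<Rightarrow> ('a \<Rightarrow> 'a \<Rightarrow> 'a::zero) \<Rightarrow> 'a cochain" where
  "cochain_of_ops l r m \<psi> as =
     (if length as = 2 then
        (if \<psi> = tree_L then l (as ! 0) (as ! 1)
         else if \<psi> = tree_R then r (as ! 0) (as ! 1)
         else if \<psi> = tree_M then m (as ! 0) (as ! 1)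
         else 0)
      else 0)"

text \<open>For a series \<open>\<Theta>\<close> of 2-cochains, \<open>op_series tree_L \<Theta>\<close>, \<open>op_series tree_R \<Theta>\<close> and
  \<open>op_series tree_M \<Theta>\<close> are \<open>L\<^sub>t\<close>, \<open>R\<^sub>t\<close> and \<open>M\<^sub>t\<close>.\<close>

definition op_series :: "ptree \<Rightarrow> 'a cochain fps \<Rightarrow> ('a \<Rightarrow> 'a \<Rightarrow> 'a) fps" where
  "op_series \<psi> \<Theta> = Abs_fps (\<lambda>i x y. fps_nth \<Theta> i \<psi> [x, y])"

text \<open>The action of a series of (bi)linear maps on power series over \<open>A\<close>, extended
  \<open>t\<close>-linearly.\<close>

definition ext_bin :: "('a \<Rightarrow> 'a \<Rightarrow> 'a::ab_group_add) fps \<Rightarrow> 'a fps \<Rightarrow> 'a fps \<Rightarrow> 'a fps" where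
  "ext_bin F X Y = Abs_fps (\<lambda>n. \<Sum>i\<le>n. \<Sum>j\<le>n - i.
     fps_nth F i (fps_nth X j) (fps_nth Y (n - i - j)))"

definition ext_un :: "('a \<Rightarrow> 'a::ab_group_add) fps \<Rightarrow> 'a fps \<Rightarrow> 'a fps" where
  "ext_un F X = Abs_fps (\<lambda>n. \<Sum>i\<le>n. fps_nth F i (fps_nth X (n - i)))"

definition is_deformation ::
  "('k::field \<Rightarrow> 'a::ab_group_add \<Rightarrow> 'a) \<Rightarrow> ('a \<Rightarrow> 'a \<Rightarrow> 'a) \<Rightarrow> ('a \<Rightarrow> 'a \<Rightarrow> 'a) \<Rightarrow> ('a \<Rightarrow> 'a \<Rightarrow> 'a)
    \<Rightarrow> 'a cochain fps \<Rightarrow> bool" where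
  "is_deformation scale L R M \<Theta> \<longleftrightarrow>
     (\<forall>i. fps_nth \<Theta> i \<in> trias_C scale 2) \<and>
     fps_nth \<Theta> 0 = cochain_of_ops L R M \<and>
     (\<forall>x y z. trias_identities
        (ext_bin (op_series tree_L \<Theta>)) (ext_bin (op_series tree_R \<Theta>)) (ext_bin (op_series tree_M \<Theta>))
        (fps_const x) (fps_const y) (fps_const z))"

definition formal_isomorphism ::
  "('k::field \<Rightarrow> 'a::ab_group_add \<Rightarrow> 'a) \<Rightarrow> ('a \<Rightarrow> 'a) fps \<Rightarrow> bool" where
  "formal_isomorphism scale \<Phi> \<longleftrightarrow>
     (\<forall>i. Vector_Spaces.linear scale scale (fps_nth \<Phi> i)) \<and> fps_nth \<Phi> 0 = id"

text \<open>A formal isomorphism acts bijectively on power series over \<open>A\<close>, so \<open>inv (ext_un \<Phi>)\<close> is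
  the action of its inverse.\<close>

definition equivalent_deformations ::
  "('k::field \<Rightarrow> 'a::ab_group_add \<Rightarrow> 'a) \<Rightarrow> 'a cochain fps \<Rightarrow> 'a cochain fps \<Rightarrow> bool" where
  "equivalent_deformations scale \<Theta> \<Theta>' \<longleftrightarrow>
     (\<exists>\<Phi>. formal_isomorphism scale \<Phi> \<and>
        (\<forall>\<psi>\<in>{tree_L, tree_R, tree_M}. \<forall>x y.
           ext_bin (op_series \<psi> \<Theta>') (fps_const x) (fps_const y) =
           ext_un \<Phi> (ext_bin (op_series \<psi> \<Theta>)
             (inv (ext_un \<Phi>) (fps_const x)) (inv (ext_un \<Phi>) (fps_const y)))))"

definition trivial_deformation ::
  "('a \<Rightarrow> 'a \<Rightarrow> 'a) \<Rightarrow> ('a \<Rightarrow> 'a \<Rightarrow> 'a) \<Rightarrow> ('a \<Rightarrow> 'a \<Rightarrow> 'a::ab_group_add) \<Rightarrow> 'a cochain fps" where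
  "trivial_deformation L R M = fps_const (cochain_of_ops L R M)"

definition rigid ::
  "('k::field \<Rightarrow> 'a::ab_group_add \<Rightarrow> 'a) \<Rightarrow> ('a \<Rightarrow> 'a \<Rightarrow> 'a) \<Rightarrow> ('a \<Rightarrow> 'a \<Rightarrow> 'a) \<Rightarrow> ('a \<Rightarrow> 'a \<Rightarrow> 'a)
    \<Rightarrow> bool" where
  "rigid scale L R M \<longleftrightarrow>
     (\<forall>\<Theta>. is_deformation scale L R M \<Theta> \<longrightarrow>
        equivalent_deformations scale \<Theta> (trivial_deformation L R M))"

end

theory Submission
  imports Defs
begin

text \<open>Given a deformation \<open>\<Theta>\<^sub>t\<close>, the coefficients of a formal isomorphism with
  \<open>\<Phi>\<^sub>t(\<Theta>\<^sub>t(x, y)) = \<Theta>\<^sub>0(\<Phi>\<^sub>t x, \<Phi>\<^sub>t y)\<close> are chosen one at a time. If the equation holds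
  modulo \<open>t\<^sup>n\<close>, then the difference of its two sides at \<open>t\<^sup>n\<close> is the lowest term of a deformation
  conjugate to \<open>\<Theta>\<^sub>t\<close>, hence a 2-cocycle: the eleven identities correspond to the eleven trees of
  degree 3. As a coboundary \<open>\<delta>\<chi>\<close> it is removed by replacing \<open>\<phi>\<^sub>n\<close> with \<open>\<phi>\<^sub>n + \<chi>\<close>. Working with
  this form of the equation avoids composing infinitely many isomorphisms, and \<open>\<Phi>\<^sub>t\<^bsup>-1\<^esup>\<close> enters
  only at the end.\<close>

section \<open>Power series of operations\<close>

lemma bilinear_op_left: "bilinear_op scale f \<Longrightarrow> Vector_Spaces.linear scale scale (\<lambda>x. f x y)"
  and bilinear_op_right: "bilinear_op scale f \<Longrightarrow> Vector_Spaces.linear scale scale (f x)"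
  by (auto simp: bilinear_op_def)

lemmas linear_add = module_hom.add[OF Vector_Spaces.linear.axioms(3)]
lemmas linear_sum = module_hom.sum[OF Vector_Spaces.linear.axioms(3)]
lemmas linear_zero = module_hom.zero[OF Vector_Spaces.linear.axioms(3)]

lemmas bilinear_op_simps =
  linear_add[OF bilinear_op_left] linear_add[OF bilinear_op_right]
  linear_sum[OF bilinear_op_left] linear_sum[OF bilinear_op_right]
  linear_zero[OF bilinear_op_left] linear_zero[OF bilinear_op_right]

section \<open>Composition of operation series as convolution of coefficients\<close>

lemma ext_bin_const_nth:
  "fps_nth (ext_bin (fps_const f) X Y) n = (\<Sum>j\<le>n. f (fps_nth X j) (fps_nth Y (n - j)))"
proof -
  have "fps_nth (ext_bin (fps_const f) X Y) n =
      (\<Sum>i\<le>n. if i = 0 then \<Sum>j\<le>n. f (fps_nth X j) (fps_nth Y (n - j)) else 0)"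
    unfolding ext_bin_def fps_nth_Abs_fps by (rule sum.cong) auto
  then show ?thesis by simp
qed

text \<open>Both sides sum \<open>F_i (G_a X_j Y_l)\<close> over i + a + j + l = n. Linearity takes
  the finite sums out of \<open>F_i\<close>; the bijection merges i and a into m = i + a.\<close>

lemma ext_un_ext_bin:
  assumes "\<And>i. Vector_Spaces.linear scale scale (fps_nth F i)"
  shows "ext_un F (ext_bin G X Y) =
    ext_bin (Abs_fps (\<lambda>m x y. \<Sum>i\<le>m. fps_nth F i (fps_nth G (m - i) x y))) X Y"
  unfolding ext_un_def ext_bin_def fps_nth_Abs_fps linear_sum[OF assms]
  by (auto simp: fps_eq_iff sum.Sigma
      intro!: sum.reindex_bij_witness[where j = "\<lambda>(i, a, j). (i + a, j, i)"
                                        and i = "\<lambda>(m, j, i). (i, m - i, j)"])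

text \<open>Same regrouping: a and b are the degrees taken from the two copies of F, p is the total
  degree of the left argument, and m = a + b.\<close>

lemma ext_bin_ext_un:
  assumes "bilinear_op scale f"
  shows "ext_bin (fps_const f) (ext_un F X) (ext_un F Y) =
    ext_bin (Abs_fps (\<lambda>m x y. \<Sum>i\<le>m. f (fps_nth F i x) (fps_nth F (m - i) y))) X Y"
  unfolding fps_eq_iff ext_bin_const_nth
  unfolding ext_un_def ext_bin_def fps_nth_Abs_fps bilinear_op_simps[OF assms]
  by (auto simp: sum.Sigma add.commute
      intro!: sum.reindex_bij_witness[where j = "\<lambda>(p, b, a). (a + b, p - a, a)"
                                        and i = "\<lambda>(m, j, i). (i + j, m - i, i)"])

text \<open>All eleven identities have the shape \<open>p (q x y) z = p' x (q' y z)\<close> with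
  operations among L, R, M, so this single scheme carries each of them over to power series.\<close>

lemma ext_bin_const_assoc:
  assumes "bilinear_op scale p" "bilinear_op scale p'"
    and "\<And>x y z. p (q x y) z = p' x (q' y z)"
  shows "ext_bin (fps_const p) (ext_bin (fps_const q) X Y) Z =
    ext_bin (fps_const p') X (ext_bin (fps_const q') Y Z)"
  unfolding fps_eq_iff ext_bin_const_nth
    bilinear_op_simps[OF assms(1)] bilinear_op_simps[OF assms(2)] assms(3)
  by (auto simp: sum.Sigma
      intro!: sum.reindex_bij_witness[where j = "\<lambda>(m, j). (j, m - j)"
                                        and i = "\<lambda>(j, k). (j + k, j)"])

lemma ext_bin_const_add_left:
  assumes "bilinear_op scale f"
  shows "ext_bin (fps_const f) (X + X') Y = ext_bin (fps_const f) X Y + ext_bin (fps_const f) X' Y"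
  by (simp add: fps_eq_iff ext_bin_const_nth bilinear_op_simps[OF assms] sum.distrib)

lemma ext_bin_const_add_right:
  assumes "bilinear_op scale f"
  shows "ext_bin (fps_const f) X (Y + Y') = ext_bin (fps_const f) X Y + ext_bin (fps_const f) X Y'"
  by (simp add: fps_eq_iff ext_bin_const_nth bilinear_op_simps[OF assms] sum.distrib)

text \<open>Degree n is used up by D, so only the constant terms of X and Y can contribute. For n =
  0 the assumption is vacuous and the constant term of any product results.\<close>

lemma ext_bin_lowest:
  assumes "\<And>m x y. m < n \<Longrightarrow> fps_nth D m x y = 0"
  shows "fps_nth (ext_bin D X Y) n = fps_nth D n (fps_nth X 0) (fps_nth Y 0)"
proof -
  have "fps_nth (ext_bin D X Y) n =
      (\<Sum>i\<le>n. if i = n then fps_nth D n (fps_nth X 0) (fps_nth Y 0) else 0)"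
    unfolding ext_bin_def fps_nth_Abs_fps by (rule sum.cong) (auto simp: assms)
  then show ?thesis by simp
qed

lemma ext_bin_const_lowest_left:
  assumes "bilinear_op scale f" "\<And>m. m < n \<Longrightarrow> fps_nth X m = 0"
  shows "fps_nth (ext_bin (fps_const f) X Y) n = f (fps_nth X n) (fps_nth Y 0)"
proof -
  have "fps_nth (ext_bin (fps_const f) X Y) n =
      (\<Sum>j\<le>n. if j = n then f (fps_nth X n) (fps_nth Y 0) else 0)"
    unfolding ext_bin_const_nth
    by (rule sum.cong) (auto simp: assms bilinear_op_simps[OF assms(1)])
  then show ?thesis by simp
qed

lemma ext_bin_const_lowest_right:
  assumes "bilinear_op scale f" "\<And>m. m < n \<Longrightarrow> fps_nth Y m = 0"
  shows "fps_nth (ext_bin (fps_const f) X Y) n = f (fps_nth X 0) (fps_nth Y n)"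
proof -
  have "fps_nth (ext_bin (fps_const f) X Y) n =
      (\<Sum>j\<le>n. if j = 0 then f (fps_nth X 0) (fps_nth Y n) else 0)"
    unfolding ext_bin_const_nth
    by (rule sum.cong) (auto simp: assms bilinear_op_simps[OF assms(1)])
  then show ?thesis by simp
qed

text \<open>Solves \<open>ext_un F P = Y\<close> degree by degree: when \<open>F_0\<close> is the
  identity, the unknown \<open>P_n\<close> stands alone and all other terms involve earlier
  coefficients.\<close>

fun ext_un_preimage :: "('a \<Rightarrow> 'a::ab_group_add) fps \<Rightarrow> 'a fps \<Rightarrow> nat \<Rightarrow> 'a" where
  "ext_un_preimage F Y n =
     fps_nth Y n - (\<Sum>i<n. fps_nth F (n - i) (ext_un_preimage F Y i))"

declare ext_un_preimage.simps [simp del]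

text \<open>Surjectivity makes \<open>inv (ext_un F)\<close> a right inverse, which is the form in
  which conjugation is evaluated at the end.\<close>

lemma surj_ext_un:
  assumes "fps_nth F 0 = id"
  shows "surj (ext_un F)"
proof (rule surjI)
  fix Y
  show "ext_un F (Abs_fps (ext_un_preimage F Y)) = Y"
  proof (rule fps_ext)
    fix n
    have "fps_nth (ext_un F (Abs_fps (ext_un_preimage F Y))) n =
        (\<Sum>i\<le>n. fps_nth F (n - i) (ext_un_preimage F Y i))"
      by (auto simp: ext_un_def intro!: sum.reindex_bij_witness[where i = "\<lambda>i. n - i" and j = "\<lambda>i. n - i"])
    also have "\<dots> = (\<Sum>i<n. fps_nth F (n - i) (ext_un_preimage F Y i)) + ext_un_preimage F Y n"
      using assms by (simp add: lessThan_Suc_atMost[symmetric])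
    also have "\<dots> = fps_nth Y n"
      by (simp add: ext_un_preimage.simps[of F Y n])
    finally show "fps_nth (ext_un F (Abs_fps (ext_un_preimage F Y))) n = fps_nth Y n" .
  qed
qed


section \<open>The defect of a formal isomorphism\<close>

text \<open>The bilinear coefficients of \<open>\<Phi>\<^sub>t(G\<^sub>t(x, y)) - f(\<Phi>\<^sub>t x, \<Phi>\<^sub>t y)\<close>.\<close>

definition defect ::
  "('a \<Rightarrow> 'a \<Rightarrow> 'a) \<Rightarrow> ('a \<Rightarrow> 'a) fps \<Rightarrow> ('a \<Rightarrow> 'a \<Rightarrow> 'a::ab_group_add) fps \<Rightarrow> ('a \<Rightarrow> 'a \<Rightarrow> 'a) fps"
where
  "defect f F G = Abs_fps (\<lambda>m x y.
     (\<Sum>i\<le>m. fps_nth F i (fps_nth G (m - i) x y)) -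
     (\<Sum>i\<le>m. f (fps_nth F i x) (fps_nth F (m - i) y)))"

text \<open>Both compositions are single series of operations applied to X and Y, and the defect is
  their difference. The formula thus holds for arbitrary power series, so it can be iterated on
  nested products.\<close>

lemma ext_un_ext_bin_defect:
  assumes "\<And>i. Vector_Spaces.linear scale scale (fps_nth F i)" "bilinear_op scale f"
  shows "ext_un F (ext_bin G X Y) =
    ext_bin (fps_const f) (ext_un F X) (ext_un F Y) + ext_bin (defect f F G) X Y"
  unfolding ext_un_ext_bin[OF assms(1)] ext_bin_ext_un[OF assms(2)] fps_eq_iff
  by (simp add: ext_bin_def defect_def sum.distrib[symmetric])

text \<open>A correction in a higher degree therefore preserves the equations already achieved, and
  a limit of stabilizing approximations inherits them.\<close>

lemma defect_cong:
  assumes "\<And>i. i \<le> n \<Longrightarrow> fps_nth F i = fps_nth F' i"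
  shows "fps_nth (defect f F G) n = fps_nth (defect f F' G) n"
  unfolding defect_def fps_nth_Abs_fps by (intro ext arg_cong2[where f = minus] sum.cong) (auto simp: assms)

text \<open>Only the terms pairing \<chi> with a constant coefficient change. As these are the
  identity and f, the change is minus the coboundary of \<chi>; n > 0 keeps the two ends i = 0 and i
  = n apart.\<close>

lemma defect_add_monomial:
  fixes F :: "('a \<Rightarrow> 'a::ab_group_add) fps"
  assumes "bilinear_op scale f" "0 < n" "fps_nth F 0 = id" "fps_nth G 0 = f"
    and F': "F' = F + Abs_fps (\<lambda>i. if i = n then \<chi> else 0)"
  shows "fps_nth (defect f F' G) n x y =
    fps_nth (defect f F G) n x y - (f x (\<chi> y) - \<chi> (f x y) + f (\<chi> x) y)"
proof -
  have "(\<Sum>i\<le>n. fps_nth F' i (fps_nth G (n - i) x y)) =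
      (\<Sum>i\<le>n. fps_nth F i (fps_nth G (n - i) x y) + (if i = n then \<chi> (f x y) else 0))"
    by (rule sum.cong) (auto simp: F' assms(4))
  moreover have "(\<Sum>i\<le>n. f (fps_nth F' i x) (fps_nth F' (n - i) y)) =
      (\<Sum>i\<le>n. f (fps_nth F i x) (fps_nth F (n - i) y) +
        ((if i = n then f (\<chi> x) y else 0) + (if i = 0 then f x (\<chi> y) else 0)))"
    by (rule sum.cong) (use assms(2) in \<open>auto simp: F' assms(3) bilinear_op_simps[OF assms(1)]\<close>)
  ultimately show ?thesis
    by (simp add: defect_def sum.distrib)
qed

lemma (in vector_space) bilinear_op_defect:
  assumes "\<And>i. Vector_Spaces.linear scale scale (fps_nth F i)"
    and "bilinear_op scale f" "\<And>i. bilinear_op scale (fps_nth G i)"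
  shows "bilinear_op scale (fps_nth (defect f F G) n)"
proof -
  interpret vector_space_pair scale scale ..
  note comp = Vector_Spaces.linear_compose[unfolded o_def]
  show ?thesis
    unfolding bilinear_op_def defect_def fps_nth_Abs_fps
  proof (intro conjI allI linear_compose_sub linear_compose_sum ballI)
    fix i x y
    show "Vector_Spaces.linear scale scale (\<lambda>x. fps_nth F i (fps_nth G (n - i) x y))"
      by (rule comp[OF bilinear_op_left assms(1)]) (rule assms)
    show "Vector_Spaces.linear scale scale (\<lambda>y. fps_nth F i (fps_nth G (n - i) x y))"
      by (rule comp[OF bilinear_op_right assms(1)]) (rule assms)
    show "Vector_Spaces.linear scale scale (\<lambda>x. f (fps_nth F i x) (fps_nth F (n - i) y))"
      by (rule comp[OF assms(1) bilinear_op_left]) (rule assms)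
    show "Vector_Spaces.linear scale scale (\<lambda>y. f (fps_nth F i x) (fps_nth F (n - i) y))"
      by (rule comp[OF assms(1) bilinear_op_right]) (rule assms)
  qed
qed

text \<open>Over the dual numbers \<open>A[\<epsilon>]\<close>, with \<open>(x\<^sub>0, x\<^sub>1)\<close> standing for \<open>x\<^sub>0 + \<epsilon> x\<^sub>1\<close>, this is
  the operation \<open>f + \<epsilon> e\<close>.\<close>

definition dual_op ::
  "('a \<Rightarrow> 'a \<Rightarrow> 'a::ab_group_add) \<Rightarrow> ('a \<Rightarrow> 'a \<Rightarrow> 'a) \<Rightarrow> 'a \<times> 'a \<Rightarrow> 'a \<times> 'a \<Rightarrow> 'a \<times> 'a" where
  "dual_op f e u v =
     (f (fst u) (fst v), f (fst u) (snd v) + f (snd u) (fst v) + e (fst u) (fst v))"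

text \<open>Modulo \<open>t\<^bsup>n+1\<^esup>\<close>, conjugating by \<open>F\<close> turns each \<open>G\<^sub>f\<close> into \<open>f + t\<^sup>n e\<^sub>f\<close>, where \<open>e\<^sub>f\<close>
  is the first nonzero coefficient of the defect.\<close>

lemma dual_op_defect_assoc:
  assumes lin: "\<And>i. Vector_Spaces.linear scale scale (fps_nth F i)" "fps_nth F 0 = id"
    and bil: "bilinear_op scale p" "bilinear_op scale q" "bilinear_op scale p'" "bilinear_op scale q'"
    and assoc: "\<And>x y z. p (q x y) z = p' x (q' y z)"
    and G0: "fps_nth Gq 0 = q" "fps_nth Gq' 0 = q'"
    and G: "ext_bin Gp (ext_bin Gq (fps_const x) (fps_const y)) (fps_const z) =
            ext_bin Gp' (fps_const x) (ext_bin Gq' (fps_const y) (fps_const z))"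
    and low: "\<And>m x y. m < n \<Longrightarrow> fps_nth (defect p F Gp) m x y = 0"
      "\<And>m x y. m < n \<Longrightarrow> fps_nth (defect q F Gq) m x y = 0"
      "\<And>m x y. m < n \<Longrightarrow> fps_nth (defect p' F Gp') m x y = 0"
      "\<And>m x y. m < n \<Longrightarrow> fps_nth (defect q' F Gq') m x y = 0"
  shows "dual_op p (fps_nth (defect p F Gp) n)
           (dual_op q (fps_nth (defect q F Gq) n) (x, 0) (y, 0)) (z, 0) =
         dual_op p' (fps_nth (defect p' F Gp') n) (x, 0)
           (dual_op q' (fps_nth (defect q' F Gq') n) (y, 0) (z, 0))"
proof -
  define X Y Z where "X = fps_const x" and "Y = fps_const y" and "Z = fps_const z"
  have nth0: "fps_nth X 0 = x" "fps_nth Y 0 = y" "fps_nth Z 0 = z"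
    "fps_nth (ext_un F X) 0 = x" "fps_nth (ext_un F Z) 0 = z"
    by (simp_all add: X_def Y_def Z_def ext_un_def lin(2))
  note exp = ext_un_ext_bin_defect[OF lin(1)]
  have vanish: "fps_nth (ext_bin (defect q F Gq) X Y) m = 0"
    "fps_nth (ext_bin (defect q' F Gq') Y Z) m = 0" if "m < n" for m
    using that low by (simp_all add: ext_bin_lowest)
  \<comment> \<open>The defect formula is applied to the outer product, then to the inner one. Each
    defect starts in degree n, so at \<open>t^n\<close> it meets only constant terms of the other
    factors.\<close>
  have "fps_nth (ext_un F (ext_bin Gp (ext_bin Gq X Y) Z)) n =
      fps_nth (ext_bin (fps_const p) (ext_bin (fps_const q) (ext_un F X) (ext_un F Y)) (ext_un F Z)) n
      + p (fps_nth (defect q F Gq) n x y) z + fps_nth (defect p F Gp) n (q x y) z"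
    by (simp add: exp[OF bil(1), of Gp] exp[OF bil(2), of Gq] ext_bin_const_add_left[OF bil(1)]
        ext_bin_const_lowest_left[OF bil(1)] vanish ext_bin_lowest low nth0 G0
        ext_bin_lowest[where n = 0])
  moreover have "fps_nth (ext_un F (ext_bin Gp' X (ext_bin Gq' Y Z))) n =
      fps_nth (ext_bin (fps_const p') (ext_un F X) (ext_bin (fps_const q') (ext_un F Y) (ext_un F Z))) n
      + p' x (fps_nth (defect q' F Gq') n y z) + fps_nth (defect p' F Gp') n x (q' y z)"
    by (simp add: exp[OF bil(3), of Gp'] exp[OF bil(4), of Gq'] ext_bin_const_add_right[OF bil(3)]
        ext_bin_const_lowest_right[OF bil(3)] vanish ext_bin_lowest low nth0 G0
        ext_bin_lowest[where n = 0])
  \<comment> \<open>The undeformed products agree by associativity on power series and cancel. What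
    remains is the \<epsilon>-component of the claim.\<close>
  ultimately have "p (fps_nth (defect q F Gq) n x y) z + fps_nth (defect p F Gp) n (q x y) z =
      p' x (fps_nth (defect q' F Gq') n y z) + fps_nth (defect p' F Gp') n x (q' y z)"
    using G ext_bin_const_assoc[OF bil(1,3) assoc] by (simp add: X_def Y_def Z_def add.assoc)
  then show ?thesis
    by (simp add: dual_op_def assoc bilinear_op_simps[OF bil(1)] bilinear_op_simps[OF bil(2)]
        bilinear_op_simps[OF bil(3)] bilinear_op_simps[OF bil(4)])
qed


section \<open>Trees of low degree\<close>

text \<open>The lists of children of a vertex, for a joint recursion with \<open>trees\<close>. The
  index counts leaves here, whereas \<open>trees\<close> is indexed by degree, one less.\<close>

definition forests :: "nat \<Rightarrow> ptree list set" where
  "forests n = {ts. (\<forall>t\<in>set ts. reduced t) \<and> sum_list (map num_leaves ts) = n}"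

text \<open>Reducedness rules out \<open>Graft []\<close>, which has no leaves.\<close>

lemma num_leaves_pos: "reduced t \<Longrightarrow> 0 < num_leaves t"
proof (induction t)
  case (Graft ts)
  then show ?case by (cases ts) auto
qed simp

lemma forests_0: "forests 0 = {[]}"
proof -
  have "ts = []" if "ts \<in> forests 0" for ts
    using that num_leaves_pos by (cases ts) (force simp: forests_def)+
  then show ?thesis by (auto simp: forests_def)
qed

lemma forests_Suc:
  "forests (Suc n) = (\<Union>j\<le>n. \<Union>t\<in>trees j. \<Union>ts\<in>forests (n - j). {t # ts})"
proof (intro set_eqI iffI)
  fix us assume us: "us \<in> forests (Suc n)"
  then obtain t ts where [simp]: "us = t # ts" by (cases us) (auto simp: forests_def)
  from us num_leaves_pos[of t]
  have "t \<in> trees (num_leaves t - 1)" "ts \<in> forests (n - (num_leaves t - 1))" "num_leaves t - 1 \<le> n"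
    by (auto simp: forests_def trees_def)
  then show "us \<in> (\<Union>j\<le>n. \<Union>t\<in>trees j. \<Union>ts\<in>forests (n - j). {t # ts})" by auto
qed (auto simp: forests_def trees_def)

lemma trees_0: "trees 0 = {Leaf}"
proof -
  have "t = Leaf" if "t \<in> trees 0" for t
  proof (cases t)
    case (Graft ts)
    with that obtain u v us where [simp]: "ts = u # v # us"
      by (cases ts rule: list.exhaust[case_product list.exhaust[of "tl ts"]]) (auto simp: trees_def)
    from that Graft num_leaves_pos[of u] num_leaves_pos[of v] show ?thesis
      by (auto simp: trees_def)
  qed
  then show ?thesis by (auto simp: trees_def)
qed

text \<open>The first child, of degree j, takes j + 1 of the n + 2 leaves. The bound j \<le> n
  leaves at least one leaf over, which forces a second child.\<close>

lemma trees_Suc: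
  "trees (Suc n) = (\<Union>j\<le>n. \<Union>t\<in>trees j. \<Union>ts\<in>forests (Suc n - j). {Graft (t # ts)})"
proof (intro set_eqI iffI)
  fix u assume u: "u \<in> trees (Suc n)"
  then obtain t t' ts where [simp]: "u = Graft (t # t' # ts)"
    by (cases u rule: reduced.cases) (auto simp: trees_def numeral_2_eq_2 Suc_le_length_iff)
  from u num_leaves_pos[of t] num_leaves_pos[of t']
  have "t \<in> trees (num_leaves t - 1)" "t' # ts \<in> forests (Suc n - (num_leaves t - 1))"
    "num_leaves t - 1 \<le> n"
    by (auto simp: forests_def trees_def)
  then show "u \<in> (\<Union>j\<le>n. \<Union>t\<in>trees j. \<Union>ts\<in>forests (Suc n - j). {Graft (t # ts)})" by auto
next
  fix u assume "u \<in> (\<Union>j\<le>n. \<Union>t\<in>trees j. \<Union>ts\<in>forests (Suc n - j). {Graft (t # ts)})"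
  then obtain j t ts where "j \<le> n" "t \<in> trees j" "ts \<in> forests (Suc n - j)" "u = Graft (t # ts)"
    by auto
  then show "u \<in> trees (Suc n)" by (cases ts) (auto simp: forests_def trees_def)
qed

text \<open>The recursions alternate: forests with k + 1 leaves need trees of degree at most k, and
  trees of degree k + 1 need forests with at most k + 1 leaves.\<close>

lemma trees_1: "trees 1 = {Graft [Leaf, Leaf]}"
  and trees_2: "trees 2 = {tree_L, tree_R, tree_M}"
  and trees_3: "trees 3 =
    {Graft [Leaf, Graft [Leaf, Graft [Leaf, Leaf]]],
     Graft [Leaf, Graft [Graft [Leaf, Leaf], Leaf]],
     Graft [Leaf, Graft [Leaf, Leaf, Leaf]],
     Graft [Leaf, Leaf, Graft [Leaf, Leaf]],
     Graft [Leaf, Graft [Leaf, Leaf], Leaf],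
     Graft [Leaf, Leaf, Leaf, Leaf],
     Graft [Graft [Leaf, Leaf], Graft [Leaf, Leaf]],
     Graft [Graft [Leaf, Leaf], Leaf, Leaf],
     Graft [Graft [Leaf, Graft [Leaf, Leaf]], Leaf],
     Graft [Graft [Graft [Leaf, Leaf], Leaf], Leaf],
     Graft [Graft [Leaf, Leaf, Leaf], Leaf]}"
proof -
  have f1: "forests (Suc 0) = {[Leaf]}"
    by (simp add: forests_Suc trees_0 forests_0)
  have t1: "trees (Suc 0) = {Graft [Leaf, Leaf]}"
    by (simp add: trees_Suc trees_0 f1)
  have f2: "forests (Suc (Suc 0)) = {[Leaf, Leaf], [Graft [Leaf, Leaf]]}"
    by (auto simp: forests_Suc[of "Suc 0"] atMost_Suc trees_0 t1 f1 forests_0)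
  have t2: "trees (Suc (Suc 0)) = {tree_L, tree_R, tree_M}"
    by (auto simp: trees_Suc[of "Suc 0"] atMost_Suc trees_0 t1 f1 f2 tree_L_def tree_R_def tree_M_def)
  have f3: "forests (Suc (Suc (Suc 0))) =
      {[Leaf, Leaf, Leaf], [Leaf, Graft [Leaf, Leaf]], [Graft [Leaf, Leaf], Leaf],
       [tree_L], [tree_R], [tree_M]}"
    by (auto simp: forests_Suc[of "Suc (Suc 0)"] atMost_Suc trees_0 t1 t2 f1 f2 forests_0)
  show "trees 1 = {Graft [Leaf, Leaf]}" using t1 by simp
  show "trees 2 = {tree_L, tree_R, tree_M}" using t2 by (simp add: numeral_2_eq_2)
  show "trees 3 =
    {Graft [Leaf, Graft [Leaf, Graft [Leaf, Leaf]]],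
     Graft [Leaf, Graft [Graft [Leaf, Leaf], Leaf]],
     Graft [Leaf, Graft [Leaf, Leaf, Leaf]],
     Graft [Leaf, Leaf, Graft [Leaf, Leaf]],
     Graft [Leaf, Graft [Leaf, Leaf], Leaf],
     Graft [Leaf, Leaf, Leaf, Leaf],
     Graft [Graft [Leaf, Leaf], Graft [Leaf, Leaf]],
     Graft [Graft [Leaf, Leaf], Leaf, Leaf],
     Graft [Graft [Leaf, Graft [Leaf, Leaf]], Leaf],
     Graft [Graft [Graft [Leaf, Leaf], Leaf], Leaf],
     Graft [Graft [Leaf, Leaf, Leaf], Leaf]}"
    unfolding numeral_3_eq_3
    by (auto simp: trees_Suc[of "Suc (Suc 0)"] atMost_Suc trees_0 t1 t2 f1 f2 f3
        tree_L_def tree_R_def tree_M_def)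
qed


section \<open>Cochains of degree two\<close>

lemma tree_neqs [simp]:
  "tree_L \<noteq> tree_R" "tree_L \<noteq> tree_M" "tree_R \<noteq> tree_L" "tree_R \<noteq> tree_M"
  "tree_M \<noteq> tree_L" "tree_M \<noteq> tree_R"
  by (simp_all add: tree_L_def tree_R_def tree_M_def)

lemma cochain_of_ops_simps [simp]:
  "cochain_of_ops l r m tree_L [x, y] = l x y"
  "cochain_of_ops l r m tree_R [x, y] = r x y"
  "cochain_of_ops l r m tree_M [x, y] = m x y"
  by (simp_all add: cochain_of_ops_def)

lemma bilinear_op_of_cochain:
  assumes "c \<in> trias_C scale 2" "\<psi> \<in> trees 2"
  shows "bilinear_op scale (\<lambda>x y. c \<psi> [x, y])"
proof -
  have lin: "Vector_Spaces.linear scale scale (\<lambda>x. c \<psi> (as[i := x]))" if "length as = 2" "i < 2" for as i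
    using assms that by (auto simp: trias_C_def)
  show ?thesis
    unfolding bilinear_op_def using lin[of "[_, _]" 0] lin[of "[_, _]" 1] by auto
qed

lemma cochain_of_ops_in_C:
  assumes "bilinear_op scale l" "bilinear_op scale r" "bilinear_op scale m"
  shows "cochain_of_ops l r m \<in> trias_C scale 2"
proof -
  have "Vector_Spaces.linear scale scale (\<lambda>x. cochain_of_ops l r m \<psi> (as[i := x]))"
    if "\<psi> \<in> {tree_L, tree_R, tree_M}" "length as = 2" "i < 2" for \<psi> as i
  proof -
    from that(2) obtain a b where "as = [a, b]"
      by (auto simp: numeral_2_eq_2 length_Suc_conv)
    with that assms show ?thesis
      by (auto simp: less_2_cases_iff bilinear_op_left bilinear_op_right)
  qed
  then show ?thesis
    by (auto simp: trias_C_def trees_2) (auto simp: cochain_of_ops_def)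
qed

section \<open>The cocycle condition in degree 2 and its solution when the cohomology
  vanishes\<close>

context triassociative_algebra
begin

text \<open>At each tree of degree 3, faces 0 and 2 give the \<epsilon>-part of the right-bracketed
  side of one identity, and faces 1 and 3, with sign -1, that of the left-bracketed side.\<close>

lemma coboundary_cochain_of_ops_eq_0:
  assumes "\<And>x y z. trias_identities (dual_op L l) (dual_op R r) (dual_op M m) (x, 0) (y, 0) (z, 0)"
  shows "trias_coboundary scale L R M 2 (cochain_of_ops l r m) = 0"
proof (intro ext)
  fix \<psi> as
  show "trias_coboundary scale L R M 2 (cochain_of_ops l r m) \<psi> as = 0 \<psi> as"
  proof (cases "\<psi> \<in> trees 3 \<and> length as = 3")
    case True
    then obtain x y z where as: "as = [x, y, z]"
      by (auto simp: numeral_3_eq_3 length_Suc_conv)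
    note zero = bilinear_op_simps(5,6)[OF bilinear_L] bilinear_op_simps(5,6)[OF bilinear_R]
      bilinear_op_simps(5,6)[OF bilinear_M]
    have ids:
      "L (l x y) z + l (L x y) z = L x (l y z) + l x (L y z)"
      "L (l x y) z + l (L x y) z = L x (r y z) + l x (R y z)"
      "L (r x y) z + l (R x y) z = R x (l y z) + r x (L y z)"
      "R (l x y) z + r (L x y) z = R x (r y z) + r x (R y z)"
      "R (r x y) z + r (R x y) z = R x (r y z) + r x (R y z)"
      "L (l x y) z + l (L x y) z = L x (m y z) + l x (M y z)"
      "L (m x y) z + l (M x y) z = M x (l y z) + m x (L y z)"
      "M (l x y) z + m (L x y) z = M x (r y z) + m x (R y z)"
      "M (r x y) z + m (R x y) z = R x (m y z) + r x (M y z)"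
      "R (m x y) z + r (M x y) z = R x (r y z) + r x (R y z)"
      "M (m x y) z + m (M x y) z = M x (m y z) + m x (M y z)"
      using assms[of x y z] unfolding trias_identities_def dual_op_def prod.inject fst_conv snd_conv zero
        add_0 add_0_right by blast+
    have sum4: "(\<Sum>i\<le>3. h i) = h 0 + h 1 + h 2 + h 3" for h :: "nat \<Rightarrow> 'a"
      by (simp add: numeral_3_eq_3 numeral_2_eq_2)
    have "trias_coboundary scale L R M 2 (cochain_of_ops l r m) \<psi> as =
        trias_face L R M 2 0 (cochain_of_ops l r m) \<psi> as
        - trias_face L R M 2 1 (cochain_of_ops l r m) \<psi> as
        + trias_face L R M 2 2 (cochain_of_ops l r m) \<psi> as
        - trias_face L R M 2 3 (cochain_of_ops l r m) \<psi> as"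
      using True by (simp add: trias_coboundary_def sum4)
    also have "\<dots> = 0"
      using True ids
      unfolding as trees_3
      by (elim conjE insertE emptyE)
        (simp_all add: trias_face_def cochain_of_ops_def degree_def
          tree_L_def tree_R_def tree_M_def algebra_simps)
    finally show ?thesis by simp
  next
    case False
    then show ?thesis by (auto simp: trias_coboundary_def)
  qed
qed

text \<open>Here the vanishing of the cohomology takes effect: the cocycle is the coboundary of some
  g, and \<chi> is the value of g on the only tree of degree 1.\<close>

lemma infinitesimal_deformation_trivial:
  assumes H: "trias_H scale L R M 2 = {trias_B scale L R M 2}"
    and bil: "bilinear_op scale l" "bilinear_op scale r" "bilinear_op scale m"
    and ids: "\<And>x y z. trias_identities (dual_op L l) (dual_op R r) (dual_op M m) (x, 0) (y, 0) (z, 0)"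
  obtains \<chi> where "Vector_Spaces.linear scale scale \<chi>"
    "\<And>x y. l x y = L x (\<chi> y) - \<chi> (L x y) + L (\<chi> x) y"
    "\<And>x y. r x y = R x (\<chi> y) - \<chi> (R x y) + R (\<chi> x) y"
    "\<And>x y. m x y = M x (\<chi> y) - \<chi> (M x y) + M (\<chi> x) y"
proof -
  let ?c = "cochain_of_ops l r m"
  have "?c \<in> trias_Z scale L R M 2"
    using coboundary_cochain_of_ops_eq_0[OF ids] cochain_of_ops_in_C[OF bil]
    by (simp add: trias_Z_def)
  then have "(\<lambda>b. ?c + b) ` trias_B scale L R M 2 \<in> trias_H scale L R M 2"
    unfolding trias_H_def by (rule imageI)
  with H have "(\<lambda>b. ?c + b) ` trias_B scale L R M 2 = trias_B scale L R M 2"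
    by simp
  \<comment> \<open>The coset of \<open>?c\<close> then contains \<open>?c\<close> itself, so
    equality of cosets makes \<open>?c\<close> a coboundary.\<close>
  moreover have "0 \<in> trias_B scale L R M 2"
  proof -
    have "0 \<in> trias_C scale 1"
      by (auto simp: trias_C_def linear_iff_module_hom module_hom_iff module_axioms)
    moreover have "apply_op L R M a x 0 = 0" "apply_op L R M a 0 x = 0" for a x
      by (cases a; simp add: bilinear_op_simps(5,6)[OF bilinear_L]
          bilinear_op_simps(5,6)[OF bilinear_R] bilinear_op_simps(5,6)[OF bilinear_M])+
    then have "trias_coboundary scale L R M 1 0 = 0"
      by (auto simp: fun_eq_iff trias_coboundary_def trias_face_def)
    ultimately show ?thesis by (force simp: numeral_2_eq_2)
  qed
  ultimately have "?c \<in> trias_B scale L R M 2" by (metis add.right_neutral imageI)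
  then obtain g where g: "g \<in> trias_C scale 1" and c: "?c = trias_coboundary scale L R M 1 g"
    by (auto simp: numeral_2_eq_2)
  define \<chi> where "\<chi> x = g (Graft [Leaf, Leaf]) [x]" for x
  have "Vector_Spaces.linear scale scale (\<lambda>x. g \<psi> (as[i := x]))"
    if "\<psi> \<in> trees 1" "length as = 1" "i < 1" for \<psi> as i
    using g that unfolding trias_C_def by blast
  \<comment> \<open>The entry of \<open>[0]\<close> is a placeholder, overwritten by the
    argument.\<close>
  from this[of "Graft [Leaf, Leaf]" "[0]" 0] have "Vector_Spaces.linear scale scale \<chi>"
    by (simp add: \<chi>_def[abs_def] trees_1[simplified])
  moreover
  have "trias_coboundary scale L R M 1 g \<psi> [x, y] =
      trias_face L R M 1 0 g \<psi> [x, y] - trias_face L R M 1 1 g \<psi> [x, y] + trias_face L R M 1 2 g \<psi> [x, y]"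
    if "\<psi> \<in> trees 2" for \<psi> x y
    using that by (simp add: trias_coboundary_def numeral_2_eq_2)
  then have "?c \<psi> [x, y] =
      trias_face L R M 1 0 g \<psi> [x, y] - trias_face L R M 1 1 g \<psi> [x, y] + trias_face L R M 1 2 g \<psi> [x, y]"
    if "\<psi> \<in> trees 2" for \<psi> x y
    using that by (simp only: c)
  note face = this[unfolded trees_2]
  \<comment> \<open>On a tree of degree 2 all three values of \<open>circ\<close> are the operation
    of that tree, and every leaf deletion yields the tree of degree 1.\<close>
  have "l x y = L x (\<chi> y) - \<chi> (L x y) + L (\<chi> x) y"
    "r x y = R x (\<chi> y) - \<chi> (R x y) + R (\<chi> x) y"
    "m x y = M x (\<chi> y) - \<chi> (M x y) + M (\<chi> x) y" for x y
    using face[of tree_L x y] face[of tree_R x y] face[of tree_M x y]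
    by (simp_all add: trias_face_def \<chi>_def) (simp_all add: tree_L_def tree_R_def tree_M_def degree_def)
  ultimately show thesis by (rule that)
qed

end


section \<open>Rigidity\<close>

lemma trias_identitiesD:
  assumes "trias_identities L R M x y z"
  shows "L (L x y) z = L x (L y z)" "L (L x y) z = L x (R y z)" "L (R x y) z = R x (L y z)"
    "R (L x y) z = R x (R y z)" "R (R x y) z = R x (R y z)" "L (L x y) z = L x (M y z)"
    "L (M x y) z = M x (L y z)" "M (L x y) z = M x (R y z)" "M (R x y) z = R x (M y z)"
    "R (M x y) z = R x (R y z)" "M (M x y) z = M x (M y z)"
  using assms unfolding trias_identities_def by blast+

lemma deformation_op_series_nth_0:
  assumes "is_deformation scale L R M \<Theta>"
  shows "fps_nth (op_series tree_L \<Theta>) 0 = L" "fps_nth (op_series tree_R \<Theta>) 0 = R"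
    "fps_nth (op_series tree_M \<Theta>) 0 = M"
  using assms by (auto simp: is_deformation_def op_series_def)

section \<open>Order-by-order construction of the trivializing isomorphism\<close>

context triassociative_algebra
begin

text \<open>Each conjunct is one instance of \<open>dual_op_defect_assoc\<close>, fed with the
  corresponding identity of the algebra and of the deformation.\<close>

lemma deformation_defect_cocycle:
  assumes \<Theta>: "is_deformation scale L R M \<Theta>"
    and F: "\<And>i. Vector_Spaces.linear scale scale (fps_nth F i)" "fps_nth F 0 = id"
    and low: "\<And>m x y. m < n \<Longrightarrow> fps_nth (defect L F (op_series tree_L \<Theta>)) m x y = 0"
      "\<And>m x y. m < n \<Longrightarrow> fps_nth (defect R F (op_series tree_R \<Theta>)) m x y = 0"
      "\<And>m x y. m < n \<Longrightarrow> fps_nth (defect M F (op_series tree_M \<Theta>)) m x y = 0"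
  shows "trias_identities
    (dual_op L (fps_nth (defect L F (op_series tree_L \<Theta>)) n))
    (dual_op R (fps_nth (defect R F (op_series tree_R \<Theta>)) n))
    (dual_op M (fps_nth (defect M F (op_series tree_M \<Theta>)) n)) (x, 0) (y, 0) (z, 0)"
proof -
  note nth0 = deformation_op_series_nth_0[OF \<Theta>]
  have ids: "trias_identities
      (ext_bin (op_series tree_L \<Theta>)) (ext_bin (op_series tree_R \<Theta>)) (ext_bin (op_series tree_M \<Theta>))
      (fps_const x) (fps_const y) (fps_const z)" for x y z
    using \<Theta> by (simp add: is_deformation_def)
  show ?thesis
    unfolding trias_identities_def
    by (intro conjI; rule dual_op_defect_assoc[OF F];
        (assumption | rule trias_identitiesD[OF identities] trias_identitiesD[OF ids]
          bilinear_L bilinear_R bilinear_M nth0 low)+)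
qed

text \<open>The three defects form one 2-cochain, so a single \<chi> corrects all three operations
  at once.\<close>

lemma kill_lowest_defect:
  assumes H: "trias_H scale L R M 2 = {trias_B scale L R M 2}"
    and \<Theta>: "is_deformation scale L R M \<Theta>"
    and F: "\<And>i. Vector_Spaces.linear scale scale (fps_nth F i)" "fps_nth F 0 = id"
    and n: "0 < n"
    and low: "\<And>m x y. m < n \<Longrightarrow> fps_nth (defect L F (op_series tree_L \<Theta>)) m x y = 0"
      "\<And>m x y. m < n \<Longrightarrow> fps_nth (defect R F (op_series tree_R \<Theta>)) m x y = 0"
      "\<And>m x y. m < n \<Longrightarrow> fps_nth (defect M F (op_series tree_M \<Theta>)) m x y = 0"
  obtains F' where "\<And>i. Vector_Spaces.linear scale scale (fps_nth F' i)"
    "\<And>i. i < n \<Longrightarrow> fps_nth F' i = fps_nth F i"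
    "\<And>x y. fps_nth (defect L F' (op_series tree_L \<Theta>)) n x y = 0"
    "\<And>x y. fps_nth (defect R F' (op_series tree_R \<Theta>)) n x y = 0"
    "\<And>x y. fps_nth (defect M F' (op_series tree_M \<Theta>)) n x y = 0"
proof -
  interpret vector_space_pair scale scale ..
  note nth0 = deformation_op_series_nth_0[OF \<Theta>]
  have G: "bilinear_op scale (fps_nth (op_series \<psi> \<Theta>) i)" if "\<psi> \<in> trees 2" for \<psi> i
    using \<Theta> that by (auto simp: is_deformation_def op_series_def intro: bilinear_op_of_cochain)
  obtain \<chi> where \<chi>: "Vector_Spaces.linear scale scale \<chi>"
    "\<And>x y. fps_nth (defect L F (op_series tree_L \<Theta>)) n x y = L x (\<chi> y) - \<chi> (L x y) + L (\<chi> x) y"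
    "\<And>x y. fps_nth (defect R F (op_series tree_R \<Theta>)) n x y = R x (\<chi> y) - \<chi> (R x y) + R (\<chi> x) y"
    "\<And>x y. fps_nth (defect M F (op_series tree_M \<Theta>)) n x y = M x (\<chi> y) - \<chi> (M x y) + M (\<chi> x) y"
    by (rule infinitesimal_deformation_trivial[OF H _ _ _ deformation_defect_cocycle[OF \<Theta> F low]])
      (auto intro!: bilinear_op_defect F G simp: bilinear_L bilinear_R bilinear_M trees_2)
  define F' where "F' = F + Abs_fps (\<lambda>i. if i = n then \<chi> else 0)"
  show thesis
  proof (rule that)
    show "Vector_Spaces.linear scale scale (fps_nth F' i)" for i
      using linear_compose_add[OF F(1) \<chi>(1)] F(1) by (simp add: F'_def plus_fun_def zero_fun_def)
    show "fps_nth F' i = fps_nth F i" if "i < n" for i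
      using that by (simp add: F'_def)
  qed (simp_all add: defect_add_monomial[where scale = scale, OF _ n F(2) _ F'_def] bilinear_L bilinear_R bilinear_M nth0 \<chi>)
qed

text \<open>Dependent choice gives approximations F n, correct through degree n, each keeping the
  coefficients of its predecessor up to n; their diagonal is the limit.\<close>

lemma trivializing_formal_isomorphism:
  assumes H: "trias_H scale L R M 2 = {trias_B scale L R M 2}"
    and \<Theta>: "is_deformation scale L R M \<Theta>"
  obtains \<Phi> where "formal_isomorphism scale \<Phi>"
    "\<And>n x y. fps_nth (defect L \<Phi> (op_series tree_L \<Theta>)) n x y = 0"
    "\<And>n x y. fps_nth (defect R \<Phi> (op_series tree_R \<Theta>)) n x y = 0"
    "\<And>n x y. fps_nth (defect M \<Phi> (op_series tree_M \<Theta>)) n x y = 0"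
proof -
  define good where "good n F \<longleftrightarrow> formal_isomorphism scale F \<and> (\<forall>m\<le>n. \<forall>x y.
      fps_nth (defect L F (op_series tree_L \<Theta>)) m x y = 0 \<and>
      fps_nth (defect R F (op_series tree_R \<Theta>)) m x y = 0 \<and>
      fps_nth (defect M F (op_series tree_M \<Theta>)) m x y = 0)" for n F
  note nth0 = deformation_op_series_nth_0[OF \<Theta>]
  have "\<exists>F. \<forall>n. good n (F n) \<and> (\<forall>i\<le>n. fps_nth (F (Suc n)) i = fps_nth (F n) i)"
  proof (rule dependent_nat_choice)
    \<comment> \<open>In degree 0 the defect is \<open>G_0\<close> minus f, which vanishes because
      the deformation starts at the given operations.\<close>
    have "good 0 (fps_const id)"
      by (auto simp: good_def formal_isomorphism_def defect_def nth0 zero_fun_def id_def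
          linear_iff_module_hom module_hom_iff module_axioms)
    then show "\<exists>F. good 0 F" ..
  next
    fix F n assume good: "good n F"
    obtain F' where F': "\<And>i. Vector_Spaces.linear scale scale (fps_nth F' i)"
      "\<And>i. i < Suc n \<Longrightarrow> fps_nth F' i = fps_nth F i"
      "\<And>x y. fps_nth (defect L F' (op_series tree_L \<Theta>)) (Suc n) x y = 0"
      "\<And>x y. fps_nth (defect R F' (op_series tree_R \<Theta>)) (Suc n) x y = 0"
      "\<And>x y. fps_nth (defect M F' (op_series tree_M \<Theta>)) (Suc n) x y = 0"
      by (rule kill_lowest_defect[OF H \<Theta>, of F "Suc n"])
        (use good in \<open>auto simp: good_def formal_isomorphism_def\<close>)
    have "fps_nth (defect f F' G) m = fps_nth (defect f F G) m" if "m \<le> n" for f G m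
      using that by (intro defect_cong F') simp
    with good F' have "good (Suc n) F'"
      by (auto simp: good_def formal_isomorphism_def le_Suc_eq)
    with F'(2) show "\<exists>F'. good (Suc n) F' \<and> (\<forall>i\<le>n. fps_nth F' i = fps_nth F i)"
      by auto
  qed
  then obtain F where F: "\<And>n. good n (F n)"
    and step: "\<And>n i. i \<le> n \<Longrightarrow> fps_nth (F (Suc n)) i = fps_nth (F n) i"
    by blast
  define \<Phi> where "\<Phi> = Abs_fps (\<lambda>i. fps_nth (F i) i)"
  have stable: "fps_nth \<Phi> i = fps_nth (F n) i" if "i \<le> n" for i n
    using that by (induction n rule: dec_induct) (simp_all add: \<Phi>_def step)
  show thesis
  proof (rule that)
    show "formal_isomorphism scale \<Phi>"
      using F by (auto simp: good_def formal_isomorphism_def \<Phi>_def)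
    have "fps_nth (defect f \<Phi> G) n = fps_nth (defect f (F n) G) n" for f G n
      by (rule defect_cong) (rule stable)
    then show "fps_nth (defect L \<Phi> (op_series tree_L \<Theta>)) n x y = 0"
      "fps_nth (defect R \<Phi> (op_series tree_R \<Theta>)) n x y = 0"
      "fps_nth (defect M \<Phi> (op_series tree_M \<Theta>)) n x y = 0" for n x y
      using F[of n] by (auto simp: good_def)
  qed
qed

lemma rigid_if_H2_trivial:
  assumes "trias_H scale L R M 2 = {trias_B scale L R M 2}"
  shows "rigid scale L R M"
  unfolding rigid_def
proof (intro allI impI)
  fix \<Theta> assume \<Theta>: "is_deformation scale L R M \<Theta>"
  obtain \<Phi> where \<Phi>: "formal_isomorphism scale \<Phi>"
    "\<And>n x y. fps_nth (defect L \<Phi> (op_series tree_L \<Theta>)) n x y = 0"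
    "\<And>n x y. fps_nth (defect R \<Phi> (op_series tree_R \<Theta>)) n x y = 0"
    "\<And>n x y. fps_nth (defect M \<Phi> (op_series tree_M \<Theta>)) n x y = 0"
    using trivializing_formal_isomorphism[OF assms \<Theta>] by blast
  have lin: "Vector_Spaces.linear scale scale (fps_nth \<Phi> i)" for i
    using \<Phi>(1) by (simp add: formal_isomorphism_def)
  have inv: "ext_un \<Phi> (inv (ext_un \<Phi>) X) = X" for X
    using \<Phi>(1) by (simp add: formal_isomorphism_def surj_ext_un surj_f_inv_f)
  \<comment> \<open>With zero defect, \<Phi> carries G to f on all power series; the arguments are
    then taken to be preimages of X and Y.\<close>
  have conj: "ext_bin (fps_const f) X Y =
      ext_un \<Phi> (ext_bin G (inv (ext_un \<Phi>) X) (inv (ext_un \<Phi>) Y))"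
    if "bilinear_op scale f" "\<And>n x y. fps_nth (defect f \<Phi> G) n x y = 0" for f G X Y
    by (simp add: ext_un_ext_bin_defect[OF lin that(1)] inv fps_eq_iff ext_bin_lowest that(2))
  have triv: "op_series tree_L (trivial_deformation L R M) = fps_const L"
    "op_series tree_R (trivial_deformation L R M) = fps_const R"
    "op_series tree_M (trivial_deformation L R M) = fps_const M"
    by (auto simp: op_series_def trivial_deformation_def fps_eq_iff fun_eq_iff)
  show "equivalent_deformations scale \<Theta> (trivial_deformation L R M)"
    unfolding equivalent_deformations_def
    using \<Phi>(1) conj[OF bilinear_L \<Phi>(2)] conj[OF bilinear_R \<Phi>(3)] conj[OF bilinear_M \<Phi>(4)]
    by (auto simp: triv)
qed

end

theorem corollary4p6:
  fixes scale :: "'k::field \<Rightarrow> 'a::ab_group_add \<Rightarrow> 'a"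
    and L R M :: "'a \<Rightarrow> 'a \<Rightarrow> 'a"
  assumes "triassociative_algebra scale L R M"
    and "trias_H scale L R M 2 = {trias_B scale L R M 2}"
  shows "rigid scale L R M"
  using assms by (rule triassociative_algebra.rigid_if_H2_trivial)

end
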